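(* Let $S=\{0,1\}^\ell$ with $\ell\ge 1$ be the secret space. The generation-based scheme $\Pi$ with backward and forward shares described in the context (the evolving $3$-threshold scheme of D'Arco, De Prisco and De Santis) is not secure. That is, it does not satisfy Secrecy for the evolving $3$-threshold access structure: it is not true that, for every set $C$ of at most two participants, the joint distribution of the shares held by the participants in $C$ is the same for all secrets $s\in S$.
   Context: Participants $P_1,P_2,\dots$ arrive one by one, and there may be infinitely many of them. In the evolving $3$-threshold access structure, a set of participants is qualified if and only if it has at least $3$ elements. A $(3,n)$-threshold scheme is a randomized map sending a secret $s\in S$ to $n$ shares such that any $3$ shares determine $s$ (correctness), while the joint distribution of any at most $2$ shares does not depend on $s$ (secrecy). An evolving $3$-threshold scheme is the analogue with an infinite sequence of shares, produced one at a time without changing earlier shares. Generations: let $n_0=0$ and $n_i=2^{4^i}$ for $i\ge 1$. Generation $G^i$ consists of $P_{n_{i-1}+1},\dots,P_{n_i}$ and has size $S(G^i)=n_i-n_{i-1}$. For a participant $P_t$, let $g(t)$ be the index of its generation, and let $h(t)=t-n_{g(t)-1}\in\{1,\dots,S(G^{g(t)})\}$ be its position in that generation. Ingredients of $\Pi$, all generated with independent randomness for the same secret $s$: - an evolving $3$-threshold scheme $\mathcal S^\infty$ (correct and secret) with shares $sh^\infty_1,sh^\infty_2,\dots$, one for each generation; - for each $i\ge1$, a $(3,S(G^i)+2)$-threshold scheme $\mathcal S^i$ (correct and secret) with shares $sh^i_1,\dots,sh^i_{S(G^i)},sh^i_F,sh^i_B$, where the shares $sh^i_F$, $sh^i_B$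 for all $i$ are written as bit strings of one common length; - for each $i\ge1$, a uniformly random bit string $SR^i$ of that common length. In $\Pi$, participant $P_t$, with $g=g(t)$, receives the following pieces: (P1) $sh^\infty_{g}$; (P2) the forward shares $sh^1_F,\dots,sh^{g-1}_F$; (P3) $sh^{g}_{h(t)}$; (P4) the masked backward shares $SR^{j}\oplus sh^{g}_B$ for $1\le j\le g-1$; (P5) the string $SR^{g}$. *)

theory Defs
  imports "HOL-Probability.Probability"
begin

section \<open>Threshold secret sharing\<close>

text \<open>
  A secret sharing scheme for parties in \<open>I\<close>, where the share of party \<open>i\<close> ranges over
  the measurable space \<open>M i\<close> (for the usual finite or countable share sets, a
  \<^term>\<open>count_space\<close>), is given by the joint distribution \<open>D s\<close> of all shares for each
  secret \<open>s\<close>. With \<open>I = {1..}\<close> it is an evolving scheme: a law on the infinite sequence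
  of shares, whose marginals are the laws of the shares handed out up to each time.
  Correctness is required almost surely, which in the discrete case means for every
  share vector of positive probability.
\<close>

definition sharing_scheme ::
    "'s set \<Rightarrow> 'i set \<Rightarrow> ('i \<Rightarrow> 'a measure) \<Rightarrow> ('s \<Rightarrow> ('i \<Rightarrow> 'a) measure) \<Rightarrow> bool" where
  "sharing_scheme S I M D \<longleftrightarrow>
     (\<forall>s\<in>S. prob_space (D s) \<and> sets (D s) = sets (PiM I M))"

definition joint_shares ::
    "('i \<Rightarrow> 'a measure) \<Rightarrow> ('i \<Rightarrow> 'a) measure \<Rightarrow> 'i set \<Rightarrow> ('i \<Rightarrow> 'a) measure" where
  "joint_shares M \<mu> C = distr \<mu> (PiM C M) (\<lambda>x. restrict x C)"

definition threshold_correct ::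
    "nat \<Rightarrow> 's set \<Rightarrow> 'i set \<Rightarrow> ('i \<Rightarrow> 'a measure) \<Rightarrow> ('s \<Rightarrow> ('i \<Rightarrow> 'a) measure) \<Rightarrow> bool" where
  "threshold_correct k S I M D \<longleftrightarrow>
     (\<forall>C\<subseteq>I. finite C \<and> card C = k \<longrightarrow>
        (\<exists>rec \<in> measurable (PiM C M) (count_space UNIV).
           \<forall>s\<in>S. AE x in D s. rec (restrict x C) = s))"

definition threshold_secret ::
    "nat \<Rightarrow> 's set \<Rightarrow> 'i set \<Rightarrow> ('i \<Rightarrow> 'a measure) \<Rightarrow> ('s \<Rightarrow> ('i \<Rightarrow> 'a) measure) \<Rightarrow> bool" where
  "threshold_secret k S I M D \<longleftrightarrow>
     (\<forall>C\<subseteq>I. finite C \<and> card C < k \<longrightarrow>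
        (\<forall>s\<in>S. \<forall>s'\<in>S. joint_shares M (D s) C = joint_shares M (D s') C))"

definition threshold_scheme ::
    "nat \<Rightarrow> 's set \<Rightarrow> 'i set \<Rightarrow> ('i \<Rightarrow> 'a measure) \<Rightarrow> ('s \<Rightarrow> ('i \<Rightarrow> 'a) measure) \<Rightarrow> bool" where
  "threshold_scheme k S I M D \<longleftrightarrow>
     sharing_scheme S I M D \<and> threshold_correct k S I M D \<and> threshold_secret k S I M D"


section \<open>Bit strings\<close>

definition bitstrings :: "nat \<Rightarrow> bool list set" where
  "bitstrings l = {xs. length xs = l}"

definition xor_bits :: "bool list \<Rightarrow> bool list \<Rightarrow> bool list" where
  "xor_bits xs ys = map2 (\<noteq>) xs ys"


section \<open>Generations\<close>

definition gen_end :: "nat \<Rightarrow> nat" where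
  "gen_end i = (if i = 0 then 0 else 2 ^ (4 ^ i))"

definition generation :: "nat \<Rightarrow> nat set" where
  "generation i = {gen_end (i - 1) + 1 .. gen_end i}"

definition gen_size :: "nat \<Rightarrow> nat" where
  "gen_size i = gen_end i - gen_end (i - 1)"

definition gen_of :: "nat \<Rightarrow> nat" where
  "gen_of t = (THE i. 1 \<le> i \<and> t \<in> generation i)"

definition gen_pos :: "nat \<Rightarrow> nat" where
  "gen_pos t = t - gen_end (gen_of t - 1)"


section \<open>The generation-based scheme\<close>

datatype gen_party = Member nat | Fwd | Bwd

definition gen_parties :: "nat \<Rightarrow> gen_party set" where
  "gen_parties i = Member ` {1..gen_size i} \<union> {Fwd, Bwd}"

text \<open>
  Shares may have any type; \<open>e\<close> writes the values in \<open>N\<close> as bit strings of length \<open>L\<close>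
  without loss of information.
\<close>

definition bit_encoding :: "nat \<Rightarrow> 'b measure \<Rightarrow> ('b \<Rightarrow> bool list) \<Rightarrow> bool" where
  "bit_encoding L N e \<longleftrightarrow>
     e \<in> measurable N (count_space UNIV) \<and> inj_on e (space N) \<and> e ` space N \<subseteq> bitstrings L"

type_synonym ('a, 'b) pi_share = "'a \<times> bool list list \<times> 'b \<times> bool list list \<times> bool list"

definition pi_space ::
    "(nat \<Rightarrow> 'a measure) \<Rightarrow> (nat \<Rightarrow> gen_party \<Rightarrow> 'b measure) \<Rightarrow> nat \<Rightarrow> ('a, 'b) pi_share measure"
  where
  "pi_space A B t =
     A (gen_of t) \<Otimes>\<^sub>M count_space UNIV \<Otimes>\<^sub>M B (gen_of t) (Member (gen_pos t))
       \<Otimes>\<^sub>M count_space UNIV \<Otimes>\<^sub>M count_space UNIV"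

text \<open>
  The share of participant \<open>t\<close>, computed from the shares \<open>x\<close> of the evolving scheme, the
  shares \<open>y i\<close> of the scheme of generation \<open>i\<close> and the masks \<open>r i\<close>; the lists are indexed
  by the generations \<open>1, \<dots>, gen_of t - 1\<close>.
\<close>

definition pi_share ::
    "(nat \<Rightarrow> 'b \<Rightarrow> bool list) \<Rightarrow> (nat \<Rightarrow> 'b \<Rightarrow> bool list) \<Rightarrow>
     (nat \<Rightarrow> 'a) \<Rightarrow> (nat \<Rightarrow> gen_party \<Rightarrow> 'b) \<Rightarrow> (nat \<Rightarrow> bool list) \<Rightarrow> nat \<Rightarrow> ('a, 'b) pi_share"
  where
  "pi_share encF encB x y r t =
     (let g = gen_of t in
       (x g,
        map (\<lambda>j. encF j (y j Fwd)) [1..<g],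
        y g (Member (gen_pos t)),
        map (\<lambda>j. xor_bits (r j) (encB g (y g Bwd))) [1..<g],
        r g))"

text \<open>Independence of the ingredients for a fixed secret is expressed by product measures.\<close>

definition pi_randomness ::
    "nat \<Rightarrow> ('s \<Rightarrow> (nat \<Rightarrow> 'a) measure) \<Rightarrow> (nat \<Rightarrow> 's \<Rightarrow> (gen_party \<Rightarrow> 'b) measure) \<Rightarrow> 's \<Rightarrow>
     ((nat \<Rightarrow> 'a) \<times> (nat \<Rightarrow> gen_party \<Rightarrow> 'b) \<times> (nat \<Rightarrow> bool list)) measure" where
  "pi_randomness L Dinf Dgen s =
     Dinf s \<Otimes>\<^sub>M PiM {1..} (\<lambda>i. Dgen i s)
       \<Otimes>\<^sub>M PiM {1..} (\<lambda>i. measure_pmf (pmf_of_set (bitstrings L)))"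

definition pi_scheme ::
    "nat \<Rightarrow> (nat \<Rightarrow> 'a measure) \<Rightarrow> (nat \<Rightarrow> gen_party \<Rightarrow> 'b measure) \<Rightarrow>
     (nat \<Rightarrow> 'b \<Rightarrow> bool list) \<Rightarrow> (nat \<Rightarrow> 'b \<Rightarrow> bool list) \<Rightarrow>
     ('s \<Rightarrow> (nat \<Rightarrow> 'a) measure) \<Rightarrow> (nat \<Rightarrow> 's \<Rightarrow> (gen_party \<Rightarrow> 'b) measure) \<Rightarrow>
     's \<Rightarrow> (nat \<Rightarrow> ('a, 'b) pi_share) measure" where
  "pi_scheme L A B encF encB Dinf Dgen s =
     distr (pi_randomness L Dinf Dgen s) (PiM {1..} (pi_space A B))
       (\<lambda>(x, y, r). \<lambda>t\<in>{1..}. pi_share encF encB x y r t)"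

end

theory Submission
  imports Defs
begin

text \<open>
  Take \<open>a\<close> in generation \<open>i \<ge> 2\<close> and \<open>b\<close> in a later generation \<open>g\<close>. Participant \<open>a\<close>
  holds \<open>SR\<^sup>i\<close>, which unmasks \<open>sh\<^sup>g\<^sub>B\<close> from a piece of \<open>b\<close>; with \<open>sh\<^sup>g\<^sub>B\<close> the other pieces of
  \<open>b\<close> reveal \<open>SR\<^sup>1\<close>, which in turn unmasks \<open>sh\<^sup>i\<^sub>B\<close> from a piece of \<open>a\<close>. Together with the
  share of \<open>a\<close> in the scheme of generation \<open>i\<close> and the forward share \<open>sh\<^sup>i\<^sub>F\<close> held by \<open>b\<close>,
  these are three shares of that scheme, so two participants determine the secret.
\<close>

section \<open>Generations\<close>

lemma gen_end_strict_mono: "strict_mono gen_end"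
  unfolding strict_mono_Suc_iff gen_end_def by auto

text \<open>Makes the \<open>THE\<close> in \<open>gen_of\<close> meaningful; monotonicity of
  \<open>gen_end\<close> is what separates two generations.\<close>

lemma gen_of_unique:
  assumes "1 \<le> i" "t \<in> generation i" "1 \<le> j" "t \<in> generation j"
  shows "i = j"
proof -
  have False if "1 \<le> p" "p < q" "t \<in> generation p" "t \<in> generation q" for p q
  proof -
    have "gen_end p \<le> gen_end (q - 1)"
      using that by (intro monoD[OF strict_mono_mono[OF gen_end_strict_mono]]) auto
    then show False
      using that by (auto simp: generation_def)
  qed
  then show ?thesis
    using assms by (meson linorder_neqE_nat)
qed

lemma gen_of_eq: "1 \<le> i \<Longrightarrow> t \<in> generation i \<Longrightarrow> gen_of t = i"
  unfolding gen_of_def using gen_of_unique by blast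

lemma gen_of_generation:
  assumes "1 \<le> t"
  shows "1 \<le> gen_of t" "t \<in> generation (gen_of t)"
proof -
  \<comment> \<open>Such an index exists because a strictly increasing sequence of naturals
    satisfies \<open>t \<le> gen_end t\<close>. It is not 0 since \<open>gen_end 0 = 0\<close>, and
    minimality puts \<open>t\<close> beyond the previous endpoint.\<close>
  define i where "i = (LEAST i. t \<le> gen_end i)"
  have le: "t \<le> gen_end i"
    unfolding i_def using strict_mono_imp_increasing[OF gen_end_strict_mono] by (rule LeastI)
  have "i \<noteq> 0"
    using le assms by (intro notI) (simp add: gen_end_def)
  moreover from this have "\<not> t \<le> gen_end (i - 1)"
    using not_less_Least[of "i - 1" "\<lambda>i. t \<le> gen_end i"] unfolding i_def by simp
  ultimately have "1 \<le> i" "t \<in> generation i"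
    using le by (auto simp: generation_def)
  moreover from this have "gen_of t = i"
    by (rule gen_of_eq)
  ultimately show "1 \<le> gen_of t" "t \<in> generation (gen_of t)"
    by auto
qed

lemma Member_gen_pos_in_gen_parties:
  assumes "1 \<le> t"
  shows "Member (gen_pos t) \<in> gen_parties (gen_of t)"
  using gen_of_generation[OF assms]
  by (auto simp: gen_parties_def gen_pos_def gen_size_def generation_def intro!: imageI)


section \<open>Bit strings\<close>

lemma finite_bitstrings: "finite (bitstrings l)"
  using finite_lists_length_eq[of "UNIV :: bool set" l] by (simp add: bitstrings_def)

lemma bitstrings_nonempty: "bitstrings l \<noteq> {}"
  using length_replicate[of l False] unfolding bitstrings_def by blast

text \<open>Here \<open>r1\<close>, \<open>r2\<close> are the masks of generations 1 and i,
  \<open>u\<close> the backward share of the later generation and \<open>v\<close> that of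
  generation i. The two occurrences of \<open>u\<close> cancel, leaving r1 xor r2, which unmasks
  \<open>v\<close>; so \<open>u\<close> itself is never computed. Equal lengths matter because
  \<open>map2\<close> truncates.\<close>

lemma xor_bits_cancel_masks:
  assumes "r1 \<in> bitstrings L" "r2 \<in> bitstrings L" "u \<in> bitstrings L" "v \<in> bitstrings L"
  shows "xor_bits (xor_bits (xor_bits r1 u) (xor_bits r2 u)) (xor_bits r2 (xor_bits r1 v)) = v"
  using assms by (intro nth_equalityI) (auto simp: bitstrings_def xor_bits_def)

text \<open>Injectivity allows inversion on the image. Words outside it go to a fixed point
  \<open>x0\<close>, which keeps all values in \<open>space N\<close>; measurability is automatic on
  a discrete domain.\<close>

lemma bit_encoding_decoder:
  assumes "bit_encoding L N e" "space N \<noteq> {}"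
  obtains d where "d \<in> measurable (count_space UNIV) N" "\<And>x. x \<in> space N \<Longrightarrow> d (e x) = x"
proof -
  obtain x0 where x0: "x0 \<in> space N"
    using assms(2) by blast
  define d where "d w = (if w \<in> e ` space N then inv_into (space N) e w else x0)" for w
  have "d \<in> measurable (count_space UNIV) N"
    using x0 by (auto simp: d_def inv_into_into)
  moreover have "d (e x) = x" if "x \<in> space N" for x
    using assms(1) that by (auto simp: d_def bit_encoding_def)
  ultimately show ?thesis
    by (rule that)
qed


section \<open>Measurability\<close>

text \<open>Used for the lists of forward and of masked backward shares. Countability of
  \<open>'c\<close> makes the product of the discrete spaces of heads and tails discrete, so that
  cons is measurable.\<close>

lemma measurable_map_count_space:
  fixes f :: "'i \<Rightarrow> 'x \<Rightarrow> 'c :: countable"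
  assumes "\<And>j. j \<in> set js \<Longrightarrow> f j \<in> measurable M (count_space UNIV)"
  shows "(\<lambda>x. map (\<lambda>j. f j x) js) \<in> measurable M (count_space UNIV)"
  using assms
proof (induction js)
  case (Cons j js)
  have [measurable]: "f j \<in> measurable M (count_space UNIV)"
    "(\<lambda>x. map (\<lambda>j. f j x) js) \<in> measurable M (count_space UNIV)"
    using Cons by auto
  have "(\<lambda>x. f j x # map (\<lambda>j. f j x) js) \<in> measurable M (count_space UNIV)"
    by measurable
  then show ?case
    by simp
qed simp

text \<open>The ingredients without their laws. Nothing here depends on the secret, so measurability
  is settled once for all secrets.\<close>

abbreviation ingredient_space ::
    "(nat \<Rightarrow> 'a measure) \<Rightarrow> (nat \<Rightarrow> gen_party \<Rightarrow> 'b measure) \<Rightarrow>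
     ((nat \<Rightarrow> 'a) \<times> (nat \<Rightarrow> gen_party \<Rightarrow> 'b) \<times> (nat \<Rightarrow> bool list)) measure" where
  "ingredient_space A B \<equiv>
     PiM {1..} A \<Otimes>\<^sub>M PiM {1..} (\<lambda>i. PiM (gen_parties i) (B i)) \<Otimes>\<^sub>M
       PiM {1..} (\<lambda>i. count_space UNIV)"

lemma measurable_generation_share:
  assumes "1 \<le> i" "p \<in> gen_parties i"
  shows "(\<lambda>\<omega>. fst (snd \<omega>) i p) \<in> measurable (ingredient_space A B) (B i p)"
proof -
  have [measurable]: "(\<lambda>y. y i) \<in> measurable (PiM {1..} (\<lambda>i. PiM (gen_parties i) (B i)))
      (PiM (gen_parties i) (B i))"
    using assms(1) by (intro measurable_component_singleton) auto
  have [measurable]: "(\<lambda>z. z p) \<in> measurable (PiM (gen_parties i) (B i)) (B i p)"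
    using assms(2) by (intro measurable_component_singleton) auto
  show ?thesis
    by measurable
qed

lemma measurable_mask:
  assumes "1 \<le> i"
  shows "(\<lambda>\<omega>. snd (snd \<omega>) i) \<in> measurable (ingredient_space A B) (count_space UNIV)"
proof -
  have [measurable]: "(\<lambda>r. r i) \<in> measurable
      (PiM {1..} (\<lambda>i. count_space UNIV :: bool list measure)) (count_space UNIV)"
    using assms by (intro measurable_component_singleton) auto
  show ?thesis
    by measurable
qed

text \<open>Makes the pushforward in \<open>pi_scheme\<close> a genuine law of shares. The index
  lists start at 1, so only coordinates present in the product are read.\<close>

lemma measurable_pi_share:
  assumes "1 \<le> t"
    and encF: "\<And>i. i \<ge> 1 \<Longrightarrow> bit_encoding L (B i Fwd) (encF i)"
    and encB: "\<And>i. i \<ge> 1 \<Longrightarrow> bit_encoding L (B i Bwd) (encB i)"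
  shows "(\<lambda>(x, y, r). pi_share encF encB x y r t)
           \<in> measurable (ingredient_space A B) (pi_space A B t)"
proof -
  let ?g = "gen_of t"
  note g = gen_of_generation(1)[OF assms(1)]
  have fwd: "(\<lambda>\<omega>. encF j (fst (snd \<omega>) j Fwd)) \<in>
      measurable (ingredient_space A B) (count_space UNIV)" if "1 \<le> j" for j
    using encF[OF that] that
    by (intro measurable_compose[OF measurable_generation_share[of j Fwd]])
      (auto simp: bit_encoding_def gen_parties_def)
  have [measurable]: "(\<lambda>\<omega>. encB ?g (fst (snd \<omega>) ?g Bwd)) \<in>
      measurable (ingredient_space A B) (count_space UNIV)"
    using encB[OF g] g
    by (intro measurable_compose[OF measurable_generation_share[of ?g Bwd]])
      (auto simp: bit_encoding_def gen_parties_def)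
  have masked: "(\<lambda>\<omega>. xor_bits (snd (snd \<omega>) j) (encB ?g (fst (snd \<omega>) ?g Bwd))) \<in>
      measurable (ingredient_space A B) (count_space UNIV)" if "1 \<le> j" for j
  proof -
    note [measurable] = measurable_mask[OF that]
    show ?thesis
      by measurable
  qed
  have [measurable]: "(\<lambda>x. x ?g) \<in> measurable (PiM {1..} A) (A ?g)"
    using g by (intro measurable_component_singleton) auto
  have "(\<lambda>\<omega>. fst \<omega> ?g) \<in> measurable (ingredient_space A B) (A ?g)"
    by measurable
  moreover have "(\<lambda>\<omega>. map (\<lambda>j. encF j (fst (snd \<omega>) j Fwd)) [1..<?g]) \<in>
      measurable (ingredient_space A B) (count_space UNIV)"
    by (intro measurable_map_count_space fwd) auto
  moreover have "(\<lambda>\<omega>. map (\<lambda>j. xor_bits (snd (snd \<omega>) j) (encB ?g (fst (snd \<omega>) ?g Bwd)))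
      [1..<?g]) \<in> measurable (ingredient_space A B) (count_space UNIV)"
    by (intro measurable_map_count_space masked) auto
  moreover note measurable_generation_share[OF g Member_gen_pos_in_gen_parties[OF assms(1)]]
    measurable_mask[OF g]
  ultimately show ?thesis
    unfolding pi_share_def pi_space_def Let_def case_prod_beta
    by (intro measurable_Pair)
qed


section \<open>The attack\<close>

text \<open>With its mirror image below, this carries almost sure facts about one ingredient over to
  the joint randomness. The predicate must be measurable for the Fubini argument in
  \<open>AE_pair_measure\<close>.\<close>

lemma AE_pair_fst:
  assumes "prob_space M" "prob_space N" "Measurable.pred M P" "AE x in M. P x"
  shows "AE z in M \<Otimes>\<^sub>M N. P (fst z)"
proof -
  interpret M: prob_space M by fact
  interpret N: prob_space N by fact
  interpret pair_sigma_finite M N ..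
  note [measurable] = assms(3)
  show ?thesis
    by (rule AE_pair_measure) (use assms(4) in auto)
qed

lemma AE_pair_snd:
  assumes "prob_space M" "prob_space N" "Measurable.pred N P" "AE x in N. P x"
  shows "AE z in M \<Otimes>\<^sub>M N. P (snd z)"
proof -
  interpret M: prob_space M by fact
  interpret N: prob_space N by fact
  interpret pair_sigma_finite M N ..
  note [measurable] = assms(3)
  show ?thesis
    by (rule AE_pair_measure) (use assms(4) in auto)
qed

text \<open>For \<open>u\<close> of generation i and \<open>v\<close> of a later generation g:
  \<open>mv ! 0\<close> is SR^1 xor sh^g_B, \<open>mv ! (i - 1)\<close> is SR^i xor sh^g_B,
  \<open>ru\<close> is SR^i and \<open>mu ! 0\<close> is SR^1 xor sh^i_B. Lists count from 0,
  generations from 1.\<close>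

definition unmask_bwd ::
    "nat \<Rightarrow> ('a, 'b) pi_share \<Rightarrow> ('a, 'b) pi_share \<Rightarrow> bool list" where
  "unmask_bwd i u v =
     (case u of (_, _, _, mu, ru) \<Rightarrow> case v of (_, _, _, mv, _) \<Rightarrow>
        xor_bits (xor_bits (mv ! 0) (mv ! (i - 1))) (xor_bits ru (mu ! 0)))"

text \<open>\<open>2 \<le> i\<close> gives the list of \<open>a\<close> an entry masked by
  \<open>r 1\<close>, and \<open>i < gen_of b\<close> makes position \<open>i - 1\<close> valid in
  the list of \<open>b\<close>.\<close>

lemma unmask_bwd_pi_share:
  assumes "gen_of a = i" "2 \<le> i" "i < gen_of b"
    and "r 1 \<in> bitstrings L" "r i \<in> bitstrings L"
    and "encB i (y i Bwd) \<in> bitstrings L"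
    and "encB (gen_of b) (y (gen_of b) Bwd) \<in> bitstrings L"
  shows "unmask_bwd i (pi_share encF encB x y r a) (pi_share encF encB x y r b)
           = encB i (y i Bwd)"
  using assms xor_bits_cancel_masks[of "r 1" L "r i"]
  by (simp add: unmask_bwd_def pi_share_def Let_def)

section \<open>Reconstruction of the secret by two participants\<close>

lemma sharing_schemeD:
  assumes "sharing_scheme S I M D" "s \<in> S"
  shows "prob_space (D s)" "sets (D s) = sets (PiM I M)" "space (D s) = space (PiM I M)"
  using assms sets_eq_imp_space_eq unfolding sharing_scheme_def by blast+

text \<open>One \<open>R\<close> serves all secrets, since the decoders and the reconstruction map
  of generation i do not depend on the secret. The \<open>prob_space\<close> clause is included
  because almost sure claims are vacuous for the null measure.\<close>

theorem two_participants_reconstruct: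
  fixes A :: "nat \<Rightarrow> 'a measure" and B :: "nat \<Rightarrow> gen_party \<Rightarrow> 'b measure"
  assumes Dinf: "sharing_scheme S {1..} A Dinf"
    and Dgen: "\<And>i. i \<ge> 1 \<Longrightarrow> sharing_scheme S (gen_parties i) (B i) (Dgen i)"
    and correct: "threshold_correct 3 S (gen_parties i) (B i) (Dgen i)"
    and encF: "\<And>i. i \<ge> 1 \<Longrightarrow> bit_encoding L (B i Fwd) (encF i)"
    and encB: "\<And>i. i \<ge> 1 \<Longrightarrow> bit_encoding L (B i Bwd) (encB i)"
    and a: "1 \<le> a" "gen_of a = i" "2 \<le> i" and b: "1 \<le> b" "i < gen_of b"
    and "S \<noteq> {}"
  shows "\<exists>R \<in> measurable (PiM {a, b} (pi_space A B)) (count_space UNIV). \<forall>s\<in>S.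
      prob_space (joint_shares (pi_space A B) (pi_scheme L A B encF encB Dinf Dgen s) {a, b}) \<and>
      (AE z in joint_shares (pi_space A B) (pi_scheme L A B encF encB Dinf Dgen s) {a, b}. R z = s)"
proof -
  define m where "m = Member (gen_pos a)"
  define g where "g = gen_of b"
  let ?C = "{m, Fwd, Bwd}"
  have i: "1 \<le> i" and g: "1 \<le> g" "i < g"
    using a b by (auto simp: g_def)
  have C: "?C \<subseteq> gen_parties i"
    using Member_gen_pos_in_gen_parties[OF a(1)] a by (auto simp: gen_parties_def m_def)
  have FB: "Fwd \<in> gen_parties j" "Bwd \<in> gen_parties j" for j
    by (auto simp: gen_parties_def)
  have "card ?C = 3"
    by (simp add: m_def)
  with C correct obtain rec where rec[measurable]: "rec \<in> measurable (PiM ?C (B i)) (count_space UNIV)"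
    and rec_eq: "\<And>s. s \<in> S \<Longrightarrow> AE x in Dgen i s. rec (restrict x ?C) = s"
    unfolding threshold_correct_def by (metis finite.emptyI finite.insertI)

  \<comment> \<open>The decoders need a default value; any point of the probability space
    \<open>Dgen i s\<close> supplies one in each coordinate.\<close>
  have "space (B i p) \<noteq> {}" if "p \<in> gen_parties i" for p
  proof -
    obtain s where "s \<in> S"
      using \<open>S \<noteq> {}\<close> by blast
    then obtain x where "x \<in> space (PiM (gen_parties i) (B i))"
      using sharing_schemeD[OF Dgen[OF i]] prob_space.not_empty by blast
    then show ?thesis
      using that by (auto simp: space_PiM)
  qed
  then obtain dF dB where [measurable]:
      "dF \<in> measurable (count_space UNIV) (B i Fwd)" "dB \<in> measurable (count_space UNIV) (B i Bwd)"
    and dF: "\<And>x. x \<in> space (B i Fwd) \<Longrightarrow> dF (encF i x) = x"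
    and dB: "\<And>x. x \<in> space (B i Bwd) \<Longrightarrow> dB (encB i x) = x"
    using bit_encoding_decoder[OF encF[OF i]] bit_encoding_decoder[OF encB[OF i]] FB by metis

  \<comment> \<open>The input of \<open>rec\<close>, assembled from what \<open>a\<close> and
    \<open>b\<close> hold: the forward share from \<open>b\<close>, the backward share by unmasking,
    the member share from \<open>a\<close>.\<close>
  define sh where "sh z = (\<lambda>p\<in>?C. if p = Fwd then dF (fst (snd (z b)) ! (i - 1))
      else if p = Bwd then dB (unmask_bwd i (z a) (z b)) else fst (snd (snd (z a))))"
    for z :: "nat \<Rightarrow> ('a, 'b) pi_share"
  have sh[measurable]: "sh \<in> measurable (PiM {a, b} (pi_space A B)) (PiM ?C (B i))"
  proof -
    have [measurable]: "(\<lambda>z. z a) \<in> measurable (PiM {a, b} (pi_space A B))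
       (A i \<Otimes>\<^sub>M count_space UNIV \<Otimes>\<^sub>M B i m \<Otimes>\<^sub>M count_space UNIV \<Otimes>\<^sub>M count_space UNIV)"
      using measurable_component_singleton[of a "{a, b}" "pi_space A B"] a
      by (simp add: pi_space_def m_def)
    have [measurable]: "(\<lambda>z. z b) \<in> measurable (PiM {a, b} (pi_space A B))
       (A g \<Otimes>\<^sub>M count_space UNIV \<Otimes>\<^sub>M B g (Member (gen_pos b)) \<Otimes>\<^sub>M count_space UNIV \<Otimes>\<^sub>M count_space UNIV)"
      using measurable_component_singleton[of b "{a, b}" "pi_space A B"]
      by (simp add: pi_space_def g_def)
    have "(\<lambda>z. dF (fst (snd (z b)) ! (i - 1))) \<in> measurable (PiM {a, b} (pi_space A B)) (B i Fwd)"
      by measurable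
    moreover have "(\<lambda>z. dB (unmask_bwd i (z a) (z b)))
        \<in> measurable (PiM {a, b} (pi_space A B)) (B i Bwd)"
      unfolding unmask_bwd_def case_prod_beta by measurable
    moreover have "(\<lambda>z. fst (snd (snd (z a)))) \<in> measurable (PiM {a, b} (pi_space A B)) (B i m)"
      by measurable
    ultimately show ?thesis
      unfolding sh_def by (intro measurable_restrict) (auto simp: m_def)
  qed

  have "prob_space (joint_shares (pi_space A B) (pi_scheme L A B encF encB Dinf Dgen s) {a, b}) \<and>
      (AE z in joint_shares (pi_space A B) (pi_scheme L A B encF encB Dinf Dgen s) {a, b}.
        rec (sh z) = s)" if s: "s \<in> S" for s
  proof -
    let ?N1 = "PiM {1..} (\<lambda>i. Dgen i s)"
    let ?N2 = "PiM {1..} (\<lambda>i. measure_pmf (pmf_of_set (bitstrings L)))"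
    let ?\<Omega> = "pi_randomness L Dinf Dgen s"
    let ?share = "\<lambda>t (x, y, r). pi_share encF encB x y r t"
    let ?f = "\<lambda>\<omega>. \<lambda>t\<in>{a, b}. ?share t \<omega>"
    note Dinf' = sharing_schemeD[OF Dinf s]
    note Dgen' = sharing_schemeD[OF Dgen s]
    have N1: "prob_space ?N1"
      using Dgen'(1) by (intro prob_space_PiM) auto
    have N2: "prob_space ?N2"
      by (intro prob_space_PiM prob_space_measure_pmf)
    have N12: "prob_space (?N1 \<Otimes>\<^sub>M ?N2)"
      by (intro prob_space_pair N1 N2)
    have \<Omega>: "prob_space ?\<Omega>"
      unfolding pi_randomness_def by (intro prob_space_pair N1 N2 Dinf')
    have sets_N1: "sets ?N1 = sets (PiM {1..} (\<lambda>i. PiM (gen_parties i) (B i)))"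
      using Dgen'(2) by (intro sets_PiM_cong) auto
    have sets_N2: "sets ?N2 = sets (PiM {1..} (\<lambda>i. count_space UNIV))"
      by (intro sets_PiM_cong) auto
    have sets_\<Omega>: "sets ?\<Omega> = sets (ingredient_space A B)"
      unfolding pi_randomness_def by (intro sets_pair_measure_cong Dinf'(2) sets_N1 sets_N2)
    have share: "?share t \<in> measurable ?\<Omega> (pi_space A B t)" if "1 \<le> t" for t
      using measurable_pi_share[OF that encF encB]
      by (simp only: measurable_cong_sets[OF sets_\<Omega> refl])
    then have all: "(\<lambda>\<omega>. \<lambda>t\<in>{1..}. ?share t \<omega>) \<in> measurable ?\<Omega> (PiM {1..} (pi_space A B))"
      by (intro measurable_restrict) auto
    have f: "?f \<in> measurable ?\<Omega> (PiM {a, b} (pi_space A B))"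
      using share a b by (intro measurable_restrict) auto
    \<comment> \<open>Two successive pushforwards merge into one, so almost sure claims about the
      two shares can be checked on the ingredients.\<close>
    have "joint_shares (pi_space A B) (pi_scheme L A B encF encB Dinf Dgen s) {a, b}
        = distr ?\<Omega> (PiM {a, b} (pi_space A B))
            ((\<lambda>z. restrict z {a, b}) \<circ> (\<lambda>\<omega>. \<lambda>t\<in>{1..}. ?share t \<omega>))"
    proof (subst distr_distr[symmetric, OF _ all])
      show "(\<lambda>z. restrict z {a, b}) \<in>
          measurable (PiM {1..} (pi_space A B)) (PiM {a, b} (pi_space A B))"
        using a b by (intro measurable_restrict_subset) auto
      have "(\<lambda>\<omega>. \<lambda>t\<in>{1..}. ?share t \<omega>) =
          (\<lambda>(x :: nat \<Rightarrow> 'a, y, r). \<lambda>t\<in>{1..}. pi_share encF encB x y r t)"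
        by auto
      then show "joint_shares (pi_space A B) (pi_scheme L A B encF encB Dinf Dgen s) {a, b} =
          distr (distr ?\<Omega> (PiM {1..} (pi_space A B)) (\<lambda>\<omega>. \<lambda>t\<in>{1..}. ?share t \<omega>))
            (PiM {a, b} (pi_space A B)) (\<lambda>z. restrict z {a, b})"
        unfolding joint_shares_def pi_scheme_def by (simp only:)
    qed
    also have "(\<lambda>z. restrict z {a, b}) \<circ> (\<lambda>\<omega>. \<lambda>t\<in>{1..}. ?share t \<omega>) = ?f"
      using a b by (auto simp: fun_eq_iff)
    finally have joint: "joint_shares (pi_space A B)
        (pi_scheme L A B encF encB Dinf Dgen s) {a, b} = distr ?\<Omega> (PiM {a, b} (pi_space A B)) ?f" .

    \<comment> \<open>The underlying space of a mask contains lists of every length; only the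
      uniform law fixes the length, hence almost surely.\<close>
    have AE_mask: "AE \<omega> in ?\<Omega>. snd (snd \<omega>) j \<in> bitstrings L" if "1 \<le> j" for j
    proof -
      have "AE w in measure_pmf (pmf_of_set (bitstrings L)). w \<in> bitstrings L"
        by (simp add: AE_measure_pmf_iff finite_bitstrings bitstrings_nonempty)
      then have ae: "AE r in ?N2. r j \<in> bitstrings L"
        using that prob_space_measure_pmf by (intro AE_PiM_component) auto
      have [measurable]: "(\<lambda>r. r j) \<in> measurable ?N2 (count_space UNIV)"
        using that measurable_component_singleton[of j "{1..}"
            "\<lambda>i. measure_pmf (pmf_of_set (bitstrings L))"] by simp
      have p: "Measurable.pred ?N2 (\<lambda>r. r j \<in> bitstrings L)"
        by measurable
      have ae': "AE \<omega> in ?N1 \<Otimes>\<^sub>M ?N2. snd \<omega> j \<in> bitstrings L"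
        by (rule AE_pair_snd[OF N1 N2 p ae])
      have p': "Measurable.pred (?N1 \<Otimes>\<^sub>M ?N2) (\<lambda>\<omega>. snd \<omega> j \<in> bitstrings L)"
        by measurable
      show ?thesis
        unfolding pi_randomness_def by (rule AE_pair_snd[OF Dinf'(1) N12 p' ae'])
    qed

    have AE_rec: "AE \<omega> in ?\<Omega>. rec (restrict (fst (snd \<omega>) i) ?C) = s"
    proof -
      have ae: "AE y in ?N1. rec (restrict (y i) ?C) = s"
        using Dgen'(1) rec_eq[OF s] i
        by (intro AE_PiM_component[where M = "\<lambda>i. Dgen i s" and i = i
              and P = "\<lambda>x. rec (restrict x ?C) = s"]) simp_all
      have "(\<lambda>y. y i) \<in> measurable (PiM {1..} (\<lambda>i. PiM (gen_parties i) (B i)))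
          (PiM (gen_parties i) (B i))"
        using i by (intro measurable_component_singleton) auto
      then have [measurable]: "(\<lambda>y. y i) \<in> measurable ?N1 (PiM (gen_parties i) (B i))"
        by (simp only: measurable_cong_sets[OF sets_N1 refl])
      have [measurable]: "(\<lambda>z. restrict z ?C) \<in>
          measurable (PiM (gen_parties i) (B i)) (PiM ?C (B i))"
        using C by (rule measurable_restrict_subset)
      have p: "Measurable.pred ?N1 (\<lambda>y. rec (restrict (y i) ?C) = s)"
        by measurable
      have ae': "AE \<omega> in ?N1 \<Otimes>\<^sub>M ?N2. rec (restrict (fst \<omega> i) ?C) = s"
        by (rule AE_pair_fst[OF N1 N2 p ae])
      have p': "Measurable.pred (?N1 \<Otimes>\<^sub>M ?N2) (\<lambda>\<omega>. rec (restrict (fst \<omega> i) ?C) = s)"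
        by measurable
      show ?thesis
        unfolding pi_randomness_def by (rule AE_pair_snd[OF Dinf'(1) N12 p' ae'])
    qed

    \<comment> \<open>Unlike the mask lengths, this holds at every sample point. It supplies the
      lengths of the encoded shares and lets the decoders apply.\<close>
    have sp: "fst (snd \<omega>) j p \<in> space (B j p)"
      if "\<omega> \<in> space ?\<Omega>" "1 \<le> j" "p \<in> gen_parties j" for \<omega> j p
      using measurable_space[OF measurable_generation_share[of j p A B], of \<omega>] that
        sets_eq_imp_space_eq[OF sets_\<Omega>] by blast
    \<comment> \<open>On the intersection of these almost sure events the attack is a pointwise
      computation; the masks involved are those of generations 1 and i.\<close>
    have "AE \<omega> in ?\<Omega>. rec (sh (?f \<omega>)) = s"
      using AE_mask[OF order_refl] AE_mask[OF i] AE_rec AE_space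
    proof eventually_elim
      case (elim \<omega>)
      obtain x y r where \<omega>: "\<omega> = (x, y, r)"
        by (cases \<omega>)
      have enc: "encB j (y j Bwd) \<in> bitstrings L" if "1 \<le> j" for j
        using sp[OF elim(4) that FB(2)] encB[OF that] by (auto simp: bit_encoding_def \<omega>)
      have "r 1 \<in> bitstrings L" "r i \<in> bitstrings L"
        using elim(1,2) by (simp_all add: \<omega>)
      then have bwd: "unmask_bwd i (?share a \<omega>) (?share b \<omega>) = encB i (y i Bwd)"
        unfolding \<omega> prod.case using enc[OF i] enc[OF g(1)[unfolded g_def]]
        by (rule unmask_bwd_pi_share[OF a(2,3) b(2)])
      have fwd: "fst (snd (?share b \<omega>)) ! (i - 1) = encF i (y i Fwd)"
        using b(2) i nth_upt[of 1 "i - 1" "gen_of b"] by (simp add: \<omega> pi_share_def Let_def)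
      have mem: "fst (snd (snd (?share a \<omega>))) = y i m"
        using a(2) by (simp add: \<omega> pi_share_def Let_def m_def)
      have dec: "dF (encF i (y i Fwd)) = y i Fwd" "dB (encB i (y i Bwd)) = y i Bwd"
        using dF[OF sp[OF elim(4) i FB(1)]] dB[OF sp[OF elim(4) i FB(2)]] by (simp_all add: \<omega>)
      have f_ab: "?f \<omega> a = ?share a \<omega>" "?f \<omega> b = ?share b \<omega>"
        by simp_all
      have "sh (?f \<omega>) = restrict (y i) ?C"
        unfolding sh_def f_ab bwd fwd mem dec by (rule restrict_ext) auto
      then show ?case
        using elim(3) by (simp only: \<omega> fst_conv snd_conv)
    qed
    moreover have "{z \<in> space (PiM {a, b} (pi_space A B)). rec (sh z) = s}
        \<in> sets (PiM {a, b} (pi_space A B))"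
      by measurable
    ultimately show ?thesis
      unfolding joint by (simp only: prob_space.prob_space_distr[OF \<Omega> f] AE_distr_iff[OF f] simp_thms)
  qed
  moreover have "(\<lambda>z. rec (sh z)) \<in> measurable (PiM {a, b} (pi_space A B)) (count_space UNIV)"
    by measurable
  ultimately show ?thesis
    by (intro bexI[of _ "\<lambda>z. rec (sh z)"] ballI)
qed

section \<open>Contradiction with secrecy\<close>

theorem mainTheorem1:
  fixes l L :: nat
    and A :: "nat \<Rightarrow> 'a measure"
    and B :: "nat \<Rightarrow> gen_party \<Rightarrow> 'b measure"
    and Dinf :: "bool list \<Rightarrow> (nat \<Rightarrow> 'a) measure"
    and Dgen :: "nat \<Rightarrow> bool list \<Rightarrow> (gen_party \<Rightarrow> 'b) measure"
    and encF encB :: "nat \<Rightarrow> 'b \<Rightarrow> bool list"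
  assumes "l \<ge> 1"
    and "threshold_scheme 3 (bitstrings l) {1..} A Dinf"
    and "\<And>i. i \<ge> 1 \<Longrightarrow> threshold_scheme 3 (bitstrings l) (gen_parties i) (B i) (Dgen i)"
    and "\<And>i. i \<ge> 1 \<Longrightarrow> bit_encoding L (B i Fwd) (encF i)"
    and "\<And>i. i \<ge> 1 \<Longrightarrow> bit_encoding L (B i Bwd) (encB i)"
  shows "\<not> threshold_secret 3 (bitstrings l) {1..} (pi_space A B)
           (pi_scheme L A B encF encB Dinf Dgen)"
proof
  assume secret: "threshold_secret 3 (bitstrings l) {1..} (pi_space A B)
    (pi_scheme L A B encF encB Dinf Dgen)"
  \<comment> \<open>The first participants of generations 2 and 3, namely 2^4 + 1 and 2^16 + 1.
    Generation 1 would not do for \<open>a\<close>, who must hold a share masked by SR^1.\<close>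
  define a b :: nat where "a = 17" and "b = 65537"
  have a: "gen_of a = 2" and b: "gen_of b = 3"
    by (rule gen_of_eq; simp add: a_def b_def generation_def gen_end_def)+
  have ab: "1 \<le> a" "1 \<le> b" "{a, b} \<subseteq> {1..}" "finite {a, b}" "card {a, b} < 3"
    by (auto simp: a_def b_def)
  define s s' where "s = replicate l False" and "s' = replicate l True"
  have s: "s \<in> bitstrings l" "s' \<in> bitstrings l" and "s \<noteq> s'"
    using \<open>l \<ge> 1\<close> by (auto simp: s_def s'_def bitstrings_def)
  let ?J = "\<lambda>s. joint_shares (pi_space A B) (pi_scheme L A B encF encB Dinf Dgen s) {a, b}"
  have "\<exists>R \<in> measurable (PiM {a, b} (pi_space A B)) (count_space UNIV).
      \<forall>s\<in>bitstrings l. prob_space (?J s) \<and> (AE z in ?J s. R z = s)"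
    using assms(2-3) a b ab bitstrings_nonempty unfolding threshold_scheme_def
    by (intro two_participants_reconstruct[where i = 2] assms(4-5)) auto
  then obtain R where R: "\<And>s. s \<in> bitstrings l \<Longrightarrow> prob_space (?J s) \<and> (AE z in ?J s. R z = s)"
    by blast
  \<comment> \<open>Secrecy identifies the two laws, so under a single probability law
    \<open>R\<close> would almost surely equal both secrets.\<close>
  have "?J s = ?J s'"
    using secret s ab unfolding threshold_secret_def by blast
  then have "AE z in ?J s. R z = s" "AE z in ?J s. R z = s'"
    using R[OF s(1)] R[OF s(2)] by metis+
  then have "AE z in ?J s. False"
    by eventually_elim (use \<open>s \<noteq> s'\<close> in simp)
  then show False
    using R[OF s(1)] prob_space.AE_False by blast
qed

end
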